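(* Let $n\ge 1$ and let $\varrho=(\rho_1,\dots,\rho_n)$ be an $n$-tuple of single-qubit density matrices $\rho_k\in\mathcal{D}(\mathbb{C}^2)$, with Bloch vectors $\mathbf{r}_1,\dots,\mathbf{r}_n\in\mathbb{R}^3$ and Gram matrix $G_{\mathbf{r}_\varrho}=(\langle \mathbf{r}_k,\mathbf{r}_l\rangle)_{k,l=1}^n$. Then $\varrho$ has coherence, i.e. $\varrho\notin\mathcal{I}_n(\mathbb{C}^2)$, if and only if $\mathrm{rank}(G_{\mathbf{r}_\varrho})\ge 2$.
   Context: $\mathcal{D}(\mathbb{C}^d)$ is the set of density matrices (positive semidefinite, trace one) on $\mathbb{C}^d$. A multi-state $\varrho:[n]\to\mathcal{D}(\mathbb{C}^d)$, $[n]=\{1,\dots,n\}$, is identified with the tuple $(\rho_1,\dots,\rho_n)$, $\rho_i=\varrho(i)$. It is incoherent if there is an orthonormal basis $\{|a_i\rangle\}_{i=1}^d$ of $\mathbb{C}^d$ such that $\langle a_i|\rho_k|a_j\rangle=0$ for all $i\ne j$ and all $k$; otherwise it has coherence. $\mathcal{I}_n(\mathbb{C}^d)$ denotes the set of incoherent $n$-tuples. The Bloch vector of $\rho\in\mathcal{D}(\mathbb{C}^2)$ is the unique $\mathbf{r}\in\mathbb{R}^3$, $\|\mathbf{r}\|\le 1$, with $\rho=\frac{1}{2}(\mathbb{1}+\mathbf{r}\cdot\boldsymbol{\sigma})$, where $\boldsymbol{\sigma}=(\sigma_x,\sigma_y,\sigma_z)$ are the Pauli matrices. *)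

theory Defs
  imports "HOL-Analysis.Analysis"
begin

text \<open>The sesquilinear inner product, conjugate-linear in the first argument (physicists'
  convention).  The library's \<open>inner\<close> on \<open>complex ^ 'd\<close> is only its real part.\<close>

definition cinner :: "complex ^ 'd \<Rightarrow> complex ^ 'd \<Rightarrow> complex" where
  "cinner x y = (\<Sum>i\<in>UNIV. cnj (x $ i) * y $ i)"

definition hermitian :: "complex ^ 'd ^ 'd \<Rightarrow> bool" where
  "hermitian A \<longleftrightarrow> (\<chi> i j. cnj (A $ j $ i)) = A"

text \<open>For Hermitian \<open>A\<close> the number \<open>cinner v (A *v v)\<close> is real, so taking \<open>Re\<close> loses nothing.\<close>

definition positive_semidefinite :: "complex ^ 'd ^ 'd \<Rightarrow> bool" where
  "positive_semidefinite A \<longleftrightarrow> hermitian A \<and> (\<forall>v. 0 \<le> Re (cinner v (A *v v)))"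

definition density_matrices :: "(complex ^ 'd ^ 'd) set" where
  "density_matrices = {A. positive_semidefinite A \<and> trace A = 1}"

definition orthonormal_basis :: "('d \<Rightarrow> complex ^ 'd) \<Rightarrow> bool" where
  "orthonormal_basis a \<longleftrightarrow>
     (\<forall>i j. cinner (a i) (a j) = (if i = j then 1 else 0)) \<and> vec.span (range a) = UNIV"

text \<open>A multi-state of \<open>n\<close> density matrices is a function on a finite index type \<open>'n\<close> with
  \<open>n = CARD('n)\<close>, and likewise \<open>d = CARD('d)\<close>.\<close>

definition incoherent_multistates :: "('n::finite \<Rightarrow> complex ^ 'd ^ 'd) set" where
  "incoherent_multistates =
     {\<rho>. (\<forall>k. \<rho> k \<in> density_matrices) \<and>
         (\<exists>a. orthonormal_basis a \<and>
              (\<forall>i j k. i \<noteq> j \<longrightarrow> cinner (a i) (\<rho> k *v a j) = 0))}"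

definition pauli_x :: "complex ^ 2 ^ 2" where
  "pauli_x = vector [vector [0, 1], vector [1, 0]]"

definition pauli_y :: "complex ^ 2 ^ 2" where
  "pauli_y = vector [vector [0, - \<i>], vector [\<i>, 0]]"

definition pauli_z :: "complex ^ 2 ^ 2" where
  "pauli_z = vector [vector [1, 0], vector [0, - 1]]"

definition is_bloch_vector :: "complex ^ 2 ^ 2 \<Rightarrow> real ^ 3 \<Rightarrow> bool" where
  "is_bloch_vector \<rho> r \<longleftrightarrow> norm r \<le> 1 \<and>
     \<rho> = (1 / 2) *\<^sub>R (mat 1 + (r $ 1 *\<^sub>R pauli_x + r $ 2 *\<^sub>R pauli_y + r $ 3 *\<^sub>R pauli_z))"

definition bloch_vector :: "complex ^ 2 ^ 2 \<Rightarrow> real ^ 3" where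
  "bloch_vector \<rho> = (THE r. is_bloch_vector \<rho> r)"

lemma bloch_vector_ex1:
  assumes "\<rho> \<in> density_matrices"
  shows "\<exists>!r. is_bloch_vector \<rho> r"
proof -
  have psd: "0 \<le> Re (cinner v (\<rho> *v v))" for v
    using assms by (simp add: density_matrices_def positive_semidefinite_def)
  have herm: "cnj (\<rho> $ j $ i) = \<rho> $ i $ j" for i j
    using assms
    by (auto simp: density_matrices_def positive_semidefinite_def hermitian_def vec_eq_iff)
  have tr: "\<rho> $ 1 $ 1 + \<rho> $ 2 $ 2 = 1"
    using assms by (simp add: density_matrices_def trace_def sum_2)
  define a b p q where "a = Re (\<rho> $ 1 $ 1)" and "b = Re (\<rho> $ 2 $ 2)"
    and "p = Re (\<rho> $ 1 $ 2)" and "q = Im (\<rho> $ 1 $ 2)"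
  note d = a_def b_def p_def q_def
  have im: "Im (\<rho> $ 1 $ 1) = 0" "Im (\<rho> $ 2 $ 2) = 0"
    using herm[of 1 1] herm[of 2 2] by (simp_all add: complex_eq_iff)
  have off: "\<rho> $ 2 $ 1 = Complex p (- q)"
    using herm[of 1 2] by (simp add: complex_eq_iff d)
  have ent: "\<rho> $ 1 $ 1 = of_real a" "\<rho> $ 2 $ 2 = of_real b" "\<rho> $ 1 $ 2 = Complex p q"
    using im by (simp_all add: complex_eq_iff d)
  have ab: "a + b = 1" using tr by (simp add: d complex_eq_iff)
  have "0 \<le> b * (a * b - (p\<^sup>2 + q\<^sup>2))"
    using psd[of "vector [of_real b, - Complex p (- q)]"]
    by (simp add: cinner_def matrix_vector_mult_def sum_2 ent off algebra_simps power2_eq_square)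
  moreover have "0 \<le> a * (a * b - (p\<^sup>2 + q\<^sup>2))"
    using psd[of "vector [- Complex p q, of_real a]"]
    by (simp add: cinner_def matrix_vector_mult_def sum_2 ent off algebra_simps power2_eq_square)
  ultimately have "0 \<le> (a + b) * (a * b - (p\<^sup>2 + q\<^sup>2))" by (simp add: algebra_simps)
  then have det: "p\<^sup>2 + q\<^sup>2 \<le> a * b" by (simp add: ab)
  define r :: "real ^ 3" where "r = vector [2 * p, - 2 * q, a - b]"
  have "(norm r)\<^sup>2 = 4 * (p\<^sup>2 + q\<^sup>2) + (a - b)\<^sup>2"
    by (simp only: power2_norm_eq_inner)
      (simp add: r_def inner_vec_def sum_3 power2_eq_square)
  also have "\<dots> \<le> (a + b)\<^sup>2" using det by (simp add: power2_eq_square algebra_simps)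
  finally have "(norm r)\<^sup>2 \<le> 1\<^sup>2" by (simp add: ab)
  then have nr: "norm r \<le> 1" by (rule power2_le_imp_le) simp
  have eq: "\<rho> = (1 / 2) *\<^sub>R (mat 1 + (s $ 1 *\<^sub>R pauli_x + s $ 2 *\<^sub>R pauli_y + s $ 3 *\<^sub>R pauli_z))
      \<longleftrightarrow> s = r" for s
    using ab
    by (auto simp: vec_eq_iff forall_2 forall_3 r_def pauli_x_def pauli_y_def pauli_z_def mat_def
        ent off complex_eq_iff)
  show ?thesis using nr by (auto simp: is_bloch_vector_def eq)
qed

definition gram_matrix :: "('n::finite \<Rightarrow> 'a::real_inner) \<Rightarrow> real ^ 'n ^ 'n" where
  "gram_matrix r = (\<chi> k l. inner (r k) (r l))"

end

theory Submission
  imports Defs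
begin

text \<open>A unit vector \<open>v = (x, y)\<close> diagonalises a qubit state with Bloch vector \<open>r\<close> iff \<open>r\<close> is
  orthogonal to the real and imaginary parts of the null vector
  \<open>(x\<^sup>2 - y\<^sup>2, \<i> (x\<^sup>2 + y\<^sup>2), - 2 x y)\<close>. These two parts and the Bloch vector of
  \<open>v v\<^sup>*\<close> form an orthonormal basis of the three-dimensional space, so the condition says that
  \<open>r\<close> is a multiple of the Bloch vector of \<open>v v\<^sup>*\<close>. Hence incoherence means that all Bloch
  vectors lie on one line, i.e. that their Gram matrix has rank at most one.\<close>

text \<open>If some \<open>r m\<close> is nonzero, its row has a nonzero diagonal entry, so in rank
  at most one it spans all rows. Proportional rows force proportional vectors because the inner
  product is definite. Asking for a unit \<open>u\<close> lets one line serve also when all vectors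
  vanish.\<close>

lemma rank_gram_matrix_le_1_iff:
  fixes r :: "'n::finite \<Rightarrow> 'a::euclidean_space"
  shows "rank (gram_matrix r) \<le> 1 \<longleftrightarrow> (\<exists>u. norm u = 1 \<and> (\<forall>k. \<exists>c. r k = c *\<^sub>R u))"
proof
  have row: "row k (gram_matrix r) = (\<chi> l. inner (r k) (r l))" for k
    by (simp add: row_def gram_matrix_def)
  have rk: "rank (gram_matrix r) = dim (rows (gram_matrix r))"
    by (simp add: row_rank_def)
  show "\<exists>u. norm u = 1 \<and> (\<forall>k. \<exists>c. r k = c *\<^sub>R u)" if "rank (gram_matrix r) \<le> 1"
  proof (cases "\<forall>k. r k = 0")
    case True
    obtain u :: 'a where "norm u = 1" using vector_choose_size[of 1] by auto
    with True show ?thesis by (metis scale_zero_left)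
  next
    case False
    then obtain m where m: "r m \<noteq> 0" by blast
    let ?w = "row m (gram_matrix r)"
    have "?w $ m \<noteq> 0" using m by (simp add: row)
    then have "?w \<noteq> 0" by (metis zero_index)
    then have ind: "independent {?w}" by (simp add: independent_insert)
    have sub: "{?w} \<subseteq> rows (gram_matrix r)" by (auto simp: rows_def)
    have "rows (gram_matrix r) \<subseteq> span {?w}"
      using card_ge_dim_independent[OF sub ind] that rk by simp
    then have "row k (gram_matrix r) \<in> span {?w}" for k by (auto simp: rows_def)
    then have "\<exists>t. row k (gram_matrix r) = t *\<^sub>R ?w" for k
      by (auto simp: span_singleton)
    then have "\<forall>k. \<exists>t. \<forall>l. inner (r k) (r l) = t * inner (r m) (r l)"
      by (simp add: row vec_eq_iff)
    from choice[OF this] obtain t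
      where t: "\<forall>k l. inner (r k) (r l) = t k * inner (r m) (r l)" ..
    have eq: "r k = t k *\<^sub>R r m" for k
    proof -
      \<comment> \<open>The difference is itself a combination of the \<open>r l\<close>, so being
        orthogonal to all of them makes it orthogonal to itself.\<close>
      have orth: "inner (r k - t k *\<^sub>R r m) (r l) = 0" for l
        using t[rule_format, of k l] by (simp add: inner_diff_left)
      have "inner (r k - t k *\<^sub>R r m) (r k - t k *\<^sub>R r m) = 0"
        by (subst inner_diff_right) (simp add: orth)
      then show ?thesis by simp
    qed
    have "r k = (t k * norm (r m)) *\<^sub>R (r m /\<^sub>R norm (r m))" for k
      by (rule trans[OF eq]) (simp add: m)
    moreover have "norm (r m /\<^sub>R norm (r m)) = 1" using m by simp
    ultimately show ?thesis by blast
  qed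
  show "rank (gram_matrix r) \<le> 1" if "\<exists>u. norm u = 1 \<and> (\<forall>k. \<exists>c. r k = c *\<^sub>R u)"
  proof -
    obtain u c where u: "norm u = 1" and c: "\<And>k. r k = c k *\<^sub>R u"
      using \<open>\<exists>u. _\<close> by metis
    have "inner u u = 1" using u by (simp add: norm_eq_1)
    then have "row k (gram_matrix r) = c k *\<^sub>R (\<chi> l. c l)" for k
      by (simp add: row c vec_eq_iff)
    then have "rows (gram_matrix r) \<subseteq> span {\<chi> l. c l}"
      by (auto simp: rows_def span_singleton)
    then have "dim (rows (gram_matrix r)) \<le> card {\<chi> l. c l}"
      by (rule dim_le_card) simp
    then show ?thesis by (simp add: rk)
  qed
qed

text \<open>The spin flip of \<open>v\<close>: orthogonal to \<open>v\<close> and of the same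
  length. Pairing with it gives a determinant: \<open>cinner (qubit_perp v) z\<close> is
  \<open>v $ 1 * z $ 2 - v $ 2 * z $ 1\<close>.\<close>

definition qubit_perp :: "complex ^ 2 \<Rightarrow> complex ^ 2" where
  "qubit_perp v = vector [- cnj (v $ 2), cnj (v $ 1)]"

text \<open>The Hopf map; for a unit \<open>v\<close> this is the Bloch vector of the projector
  \<open>v v\<^sup>*\<close>.\<close>

definition bloch_direction :: "complex ^ 2 \<Rightarrow> real ^ 3" where
  "bloch_direction v = vector [2 * Re (cnj (v $ 1) * v $ 2), 2 * Im (cnj (v $ 1) * v $ 2),
     (cmod (v $ 1))\<^sup>2 - (cmod (v $ 2))\<^sup>2]"

lemma is_bloch_vector_bloch_vector:
  assumes "\<rho> \<in> density_matrices"
  shows "is_bloch_vector \<rho> (bloch_vector \<rho>)"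
  unfolding bloch_vector_def by (rule theI'[OF bloch_vector_ex1[OF assms]])

lemma is_bloch_vector_entries:
  assumes "is_bloch_vector \<rho> r"
  shows "\<rho> $ 1 $ 1 = of_real ((1 + r $ 3) / 2)" "\<rho> $ 2 $ 2 = of_real ((1 - r $ 3) / 2)"
    "\<rho> $ 1 $ 2 = Complex (r $ 1 / 2) (- r $ 2 / 2)" "\<rho> $ 2 $ 1 = Complex (r $ 1 / 2) (r $ 2 / 2)"
  using assms
  by (simp_all add: is_bloch_vector_def pauli_x_def pauli_y_def pauli_z_def mat_def complex_eq_iff)

lemma cinner_2: "cinner (x :: complex ^ 2) y = cnj (x $ 1) * y $ 1 + cnj (x $ 2) * y $ 2"
  by (simp add: cinner_def sum_2)

lemma is_bloch_vector_parallel_bloch_direction: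
  assumes bl: "is_bloch_vector \<rho> r" and v: "cinner v v = 1"
    and z: "cinner (qubit_perp v) (\<rho> *v v) = 0"
  shows "r = inner r (bloch_direction v) *\<^sub>R bloch_direction v"
proof -
  obtain a b c d where xy: "v $ 1 = Complex a b" "v $ 2 = Complex c d"
    by (metis complex_surj)
  \<comment> \<open>Inner products of \<open>r\<close> with the real and imaginary parts of the null
    vector \<open>(x\<^sup>2 - y\<^sup>2, \<i> (x\<^sup>2 + y\<^sup>2), - 2 x y)\<close> for
    \<open>x = a + \<i> b\<close>, \<open>y = c + \<i> d\<close>.\<close>
  define W1 W2 where "W1 = r $ 1 * (a\<^sup>2 - b\<^sup>2 - c\<^sup>2 + d\<^sup>2) - 2 * r $ 2 * (a * b + c * d)
      - 2 * r $ 3 * (a * c - b * d)"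
    and "W2 = 2 * r $ 1 * (a * b - c * d) + r $ 2 * (a\<^sup>2 - b\<^sup>2 + c\<^sup>2 - d\<^sup>2)
      - 2 * r $ 3 * (a * d + b * c)"
  have "cinner (qubit_perp v) (\<rho> *v v) = Complex (W1 / 2) (W2 / 2)"
    by (simp add: cinner_2 qubit_perp_def matrix_vector_mult_def sum_2 xy
        is_bloch_vector_entries[OF bl] complex_eq_iff W1_def W2_def power2_eq_square)
      (simp add: field_simps)
  with z have W: "W1 = 0" "W2 = 0" by (simp_all add: complex_eq_iff)
  have N: "a\<^sup>2 + b\<^sup>2 + c\<^sup>2 + d\<^sup>2 = 1"
    using v by (simp add: cinner_2 xy complex_eq_iff power2_eq_square)
  define U where "U = r $ 1 * (2 * (a * c + b * d)) + r $ 2 * (2 * (a * d - b * c))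
    + r $ 3 * (a\<^sup>2 + b\<^sup>2 - c\<^sup>2 - d\<^sup>2)"
  have dir: "bloch_direction v $ 1 = 2 * (a * c + b * d)"
      "bloch_direction v $ 2 = 2 * (a * d - b * c)"
      "bloch_direction v $ 3 = a\<^sup>2 + b\<^sup>2 - c\<^sup>2 - d\<^sup>2"
    by (simp_all add: bloch_direction_def xy cmod_power2)
  have U: "inner r (bloch_direction v) = U"
    by (simp add: inner_vec_def sum_3 dir U_def)
  \<comment> \<open>Expansion of \<open>r\<close> in the orthogonal frame behind \<open>U\<close>,
    \<open>W1\<close>, \<open>W2\<close>. Each frame vector has squared length
    \<open>(a\<^sup>2 + b\<^sup>2 + c\<^sup>2 + d\<^sup>2)\<^sup>2\<close>; keeping this factor on
    the left makes the three coordinates pure polynomial identities.\<close>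
  have "(a\<^sup>2 + b\<^sup>2 + c\<^sup>2 + d\<^sup>2)\<^sup>2 * r $ 1 = U * (2 * (a * c + b * d))
      + W1 * (a\<^sup>2 - b\<^sup>2 - c\<^sup>2 + d\<^sup>2) + W2 * (2 * (a * b - c * d))"
    unfolding U_def W1_def W2_def by algebra
  moreover have "(a\<^sup>2 + b\<^sup>2 + c\<^sup>2 + d\<^sup>2)\<^sup>2 * r $ 2 = U * (2 * (a * d - b * c))
      - W1 * (2 * (a * b + c * d)) + W2 * (a\<^sup>2 - b\<^sup>2 + c\<^sup>2 - d\<^sup>2)"
    unfolding U_def W1_def W2_def by algebra
  moreover have "(a\<^sup>2 + b\<^sup>2 + c\<^sup>2 + d\<^sup>2)\<^sup>2 * r $ 3 = U * (a\<^sup>2 + b\<^sup>2 - c\<^sup>2 - d\<^sup>2)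
      - W1 * (2 * (a * c - b * d)) - W2 * (2 * (a * d + b * c))"
    unfolding U_def W1_def W2_def by algebra
  ultimately show ?thesis
    by (simp add: vec_eq_iff forall_3 U dir N W)
qed

text \<open>Such a \<open>\<rho>\<close> is a combination of the identity and
  \<open>v v\<^sup>*\<close>, so \<open>v\<close> and \<open>qubit_perp v\<close> are both
  eigenvectors.\<close>

lemma is_bloch_vector_scaled_bloch_direction_offdiag:
  assumes "is_bloch_vector \<rho> (s *\<^sub>R bloch_direction v)"
  shows "cinner (qubit_perp v) (\<rho> *v v) = 0" "cinner v (\<rho> *v qubit_perp v) = 0"
proof -
  obtain a b c d where xy: "v $ 1 = Complex a b" "v $ 2 = Complex c d"
    by (metis complex_surj)
  note simps = cinner_2 qubit_perp_def matrix_vector_mult_def sum_2 xy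
    is_bloch_vector_entries[OF assms] complex_eq_iff bloch_direction_def cmod_power2
  show "cinner (qubit_perp v) (\<rho> *v v) = 0" "cinner v (\<rho> *v qubit_perp v) = 0"
    by (simp_all add: simps) (simp_all add: field_simps power2_eq_square)
qed

lemma norm_bloch_direction:
  assumes "cinner v v = 1"
  shows "norm (bloch_direction v) = 1"
proof -
  obtain a b c d where xy: "v $ 1 = Complex a b" "v $ 2 = Complex c d"
    by (metis complex_surj)
  have N: "a\<^sup>2 + b\<^sup>2 + c\<^sup>2 + d\<^sup>2 = 1"
    using assms by (simp add: cinner_2 xy complex_eq_iff power2_eq_square)
  have "inner (bloch_direction v) (bloch_direction v) = (a\<^sup>2 + b\<^sup>2 + c\<^sup>2 + d\<^sup>2)\<^sup>2"
    by (simp add: inner_vec_def sum_3 bloch_direction_def xy cmod_power2) algebra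
  then show ?thesis by (simp add: norm_eq_1 N)
qed

lemma ex_bloch_direction:
  assumes "norm u = 1"
  shows "\<exists>v. cinner v v = 1 \<and> bloch_direction v = u"
proof -
  have n: "(u $ 1)\<^sup>2 + (u $ 2)\<^sup>2 + (u $ 3)\<^sup>2 = 1"
    using assms by (simp add: norm_eq_1 inner_vec_def sum_3 power2_eq_square)
  show ?thesis
  \<comment> \<open>The generic witness divides by its first component, which vanishes exactly at
    the south pole.\<close>
  proof (cases "u $ 3 = - 1")
    case True
    with n have "u $ 1 = 0" "u $ 2 = 0" by (simp_all add: sum_power2_eq_zero_iff)
    with True have "bloch_direction (vector [0, 1]) = u"
      by (simp add: bloch_direction_def vec_eq_iff forall_3)
    moreover have "cinner (vector [0, 1]) (vector [0, 1] :: complex ^ 2) = 1"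
      by (simp add: cinner_2)
    ultimately show ?thesis by blast
  next
    case False
    have "(u $ 3)\<^sup>2 \<le> 1" using n zero_le_power2[of "u $ 1"] zero_le_power2[of "u $ 2"] by linarith
    then have "\<bar>u $ 3\<bar> \<le> 1" by (simp add: abs_square_le_1)
    with False have pos: "0 < 1 + u $ 3" by linarith
    \<comment> \<open>Fix the phase so that the first component \<open>x\<close> is positive. Unit
      length and the third coordinate force \<open>x\<^sup>2 = (1 + u $ 3) / 2\<close>; the other
      two coordinates then determine the second component.\<close>
    define x where "x = sqrt ((1 + u $ 3) / 2)"
    have x: "x \<noteq> 0" "x\<^sup>2 = (1 + u $ 3) / 2" using pos by (simp_all add: x_def)
    define v :: "complex ^ 2"
      where "v = vector [of_real x, Complex (u $ 1 / (2 * x)) (u $ 2 / (2 * x))]"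
    have "(u $ 1 / (2 * x))\<^sup>2 + (u $ 2 / (2 * x))\<^sup>2 = ((u $ 1)\<^sup>2 + (u $ 2)\<^sup>2) / (4 * x\<^sup>2)"
      by (simp add: power_divide power_mult_distrib add_divide_distrib)
    also have "(u $ 1)\<^sup>2 + (u $ 2)\<^sup>2 = (1 - u $ 3) * (1 + u $ 3)"
      using n by algebra
    also have "4 * x\<^sup>2 = 2 * (1 + u $ 3)" by (simp add: x(2))
    also have "(1 - u $ 3) * (1 + u $ 3) / (2 * (1 + u $ 3)) = (1 - u $ 3) / 2"
      using pos by (intro mult_divide_mult_cancel_right) simp
    finally have y: "(u $ 1 / (2 * x))\<^sup>2 + (u $ 2 / (2 * x))\<^sup>2 = (1 - u $ 3) / 2" .
    have "cinner v v = of_real (x\<^sup>2 + ((u $ 1 / (2 * x))\<^sup>2 + (u $ 2 / (2 * x))\<^sup>2))"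
      by (simp add: cinner_2 v_def complex_eq_iff power2_eq_square)
    also have "\<dots> = 1" unfolding y x(2) by (simp add: add_divide_distrib[symmetric])
    finally have "cinner v v = 1" .
    moreover have "bloch_direction v = u"
      using x by (simp add: bloch_direction_def vec_eq_iff forall_3 v_def cmod_power2 y)
        (simp add: field_simps)
    ultimately show ?thesis by blast
  qed
qed

lemma orthonormal_basis_qubit:
  assumes v: "cinner v v = 1"
  shows "orthonormal_basis (\<lambda>i :: 2. if i = 1 then v else qubit_perp v)"
proof -
  let ?a = "\<lambda>i :: 2. if i = 1 then v else qubit_perp v"
  have N: "cnj (v $ 1) * v $ 1 + cnj (v $ 2) * v $ 2 = 1" using v by (simp add: cinner_2)
  have "w \<in> vec.span (range ?a)" for w
  proof -
    \<comment> \<open>Coordinates of the completeness relation: the projectors onto \<open>v\<close>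
      and \<open>qubit_perp v\<close> sum to the identity.\<close>
    have c1: "w $ 1 = cinner v w * v $ 1 + cinner (qubit_perp v) w * qubit_perp v $ 1"
      using N unfolding cinner_2 qubit_perp_def by simp algebra
    have c2: "w $ 2 = cinner v w * v $ 2 + cinner (qubit_perp v) w * qubit_perp v $ 2"
      using N unfolding cinner_2 qubit_perp_def by simp algebra
    have "w = cinner v w *s ?a 1 + cinner (qubit_perp v) w *s ?a 2"
      using c1 c2 by (simp add: vec_eq_iff forall_2)
    also have "\<dots> \<in> vec.span (range ?a)"
      by (intro vec.span_add vec.span_scale vec.span_base rangeI)
    finally show ?thesis .
  qed
  moreover have "cinner (?a i) (?a j) = (if i = j then 1 else 0)" for i j
    using N exhaust_2[of i] exhaust_2[of j]
    by (auto simp: cinner_2 qubit_perp_def algebra_simps)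
  ultimately show ?thesis by (auto simp: orthonormal_basis_def)
qed

text \<open>Since the orthogonal complement of a line in the plane is a line, orthogonality to any
  nonzero vector orthogonal to \<open>v\<close> may be tested on \<open>qubit_perp v\<close>.\<close>

lemma cinner_qubit_perp_eq_0:
  assumes "cinner w w = 1" "cinner w v = 0" "cinner w z = 0"
  shows "cinner (qubit_perp v) z = 0"
proof -
  \<comment> \<open>The determinant with columns \<open>v\<close> and \<open>z\<close>. The nonzero
    row \<open>w\<^sup>*\<close> annihilates both columns, so eliminating either of its entries
    yields a multiple of \<open>?D\<close>.\<close>
  let ?D = "v $ 1 * z $ 2 - v $ 2 * z $ 1"
  have "cnj (w $ 1) * ?D = 0" "cnj (w $ 2) * ?D = 0"
    using assms(2,3) unfolding cinner_2 by algebra+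
  moreover have "w $ 1 \<noteq> 0 \<or> w $ 2 \<noteq> 0" using assms(1) by (auto simp: cinner_2)
  ultimately have "?D = 0" by auto
  then show ?thesis by (simp add: cinner_2 qubit_perp_def algebra_simps)
qed

theorem mainTheorem2:
  fixes \<rho> :: "'n::finite \<Rightarrow> complex ^ 2 ^ 2"
  assumes "\<forall>k. \<rho> k \<in> density_matrices"
  shows "\<rho> \<notin> incoherent_multistates \<longleftrightarrow> 2 \<le> rank (gram_matrix (\<lambda>k. bloch_vector (\<rho> k)))"
proof -
  have bl: "is_bloch_vector (\<rho> k) (bloch_vector (\<rho> k))" for k
    using assms is_bloch_vector_bloch_vector by blast
  have "\<rho> \<in> incoherent_multistates \<longleftrightarrow>
    (\<exists>u. norm u = 1 \<and> (\<forall>k. \<exists>c. bloch_vector (\<rho> k) = c *\<^sub>R u))"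
  proof
    assume "\<rho> \<in> incoherent_multistates"
    then obtain a where a: "orthonormal_basis a"
      and off: "\<And>i j k. i \<noteq> j \<Longrightarrow> cinner (a i) (\<rho> k *v a j) = 0"
      by (auto simp: incoherent_multistates_def)
    have on: "cinner (a i) (a j) = (if i = j then 1 else 0)" for i j
      using a by (simp add: orthonormal_basis_def)
    \<comment> \<open>In the given basis, \<open>a 2\<close> is orthogonal both to
      \<open>a 1\<close> and to \<open>\<rho> k *v a 1\<close>; it may differ from
      \<open>qubit_perp (a 1)\<close> by a phase.\<close>
    have "cinner (qubit_perp (a 1)) (\<rho> k *v a 1) = 0" for k
      by (rule cinner_qubit_perp_eq_0[of "a 2"]) (simp_all add: on off)
    then have "bloch_vector (\<rho> k)
        = inner (bloch_vector (\<rho> k)) (bloch_direction (a 1)) *\<^sub>R bloch_direction (a 1)" for k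
      using on by (intro is_bloch_vector_parallel_bloch_direction[OF bl]) simp_all
    moreover have "norm (bloch_direction (a 1)) = 1"
      by (rule norm_bloch_direction) (simp add: on)
    ultimately show "\<exists>u. norm u = 1 \<and> (\<forall>k. \<exists>c. bloch_vector (\<rho> k) = c *\<^sub>R u)"
      by blast
  next
    assume "\<exists>u. norm u = 1 \<and> (\<forall>k. \<exists>c. bloch_vector (\<rho> k) = c *\<^sub>R u)"
    then obtain u c where "norm u = 1" and c: "\<And>k. bloch_vector (\<rho> k) = c k *\<^sub>R u"
      by metis
    then obtain v where v: "cinner v v = 1" "bloch_direction v = u"
      using ex_bloch_direction by blast
    \<comment> \<open>Only the factor \<open>c k\<close> depends on \<open>k\<close>, so the single
      basis built from \<open>v\<close> diagonalises all states at once.\<close>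
    have "is_bloch_vector (\<rho> k) (c k *\<^sub>R bloch_direction v)" for k
      using bl[of k] by (simp add: c v(2))
    note off = is_bloch_vector_scaled_bloch_direction_offdiag[OF this]
    have "cinner (if i = 1 then v else qubit_perp v)
        (\<rho> k *v (if j = 1 then v else qubit_perp v)) = 0" if "i \<noteq> j" for i j :: 2 and k
      using off[of k] that exhaust_2[of i] exhaust_2[of j] by auto
    with assms orthonormal_basis_qubit[OF v(1)] show "\<rho> \<in> incoherent_multistates"
      unfolding incoherent_multistates_def by blast
  qed
  also have "\<dots> \<longleftrightarrow> rank (gram_matrix (\<lambda>k. bloch_vector (\<rho> k))) \<le> 1"
    by (rule rank_gram_matrix_le_1_iff[symmetric])
  finally show ?thesis by linarith
qed

end
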